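(* Let $\mathcal{S}$ be a complete idempotent semiring, let $\mathrm{I}(\mathcal{S})$ be the semiring of closed intervals of $\mathcal{S}$ with its canonical order, and let $\mathbf{a}=[\underline{a},\overline{a}]\in\mathrm{I}(\mathcal{S})$. The mapping $L_{\mathbf{a}}:\mathrm{I}(\mathcal{S})\to\mathrm{I}(\mathcal{S})$, $\mathbf{x}\mapsto\mathbf{a}\mathbin{\overline{\otimes}}\mathbf{x}$, is residuated. Its residual $L_{\mathbf{a}}^\sharp:\mathrm{I}(\mathcal{S})\to\mathrm{I}(\mathcal{S})$ is given, for $\mathbf{x}=[\underline{x},\overline{x}]$, by $$L_{\mathbf{a}}^\sharp(\mathbf{x})=\mathbf{a}\mathbin{\overline{\backslash}}\mathbf{x}:=\big[(\underline{a}\backslash\underline{x})\wedge(\overline{a}\backslash\overline{x}),\ \overline{a}\backslash\overline{x}\big].$$ Therefore, for every $\mathbf{b}\in\mathrm{I}(\mathcal{S})$, $\mathbf{a}\mathbin{\overline{\backslash}}\mathbf{b}$ is the greatest solution $\mathbf{x}\in\mathrm{I}(\mathcal{S})$ of $\mathbf{a}\mathbin{\overline{\otimes}}\mathbf{x}\preceq\mathbf{b}$, and equality $\mathbf{a}\mathbin{\overline{\otimes}}(\mathbf{a}\mathbin{\overline{\backslash}}\mathbf{b})=\mathbf{b}$ is achieved if $\mathbf{b}$ belongs to the image of $L_{\mathbf{a}}$.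
   Context: A (idempotent) semiring $\mathcal{S}$ is a set with two associative operations $\oplus$, $\otimes$ with neutral elements $\varepsilon$ and $e$ respectively, where $\oplus$ is commutative and idempotent ($a\oplus a=a$), $\otimes$ distributes over $\oplus$ on both sides, and $\varepsilon$ is absorbing for $\otimes$; $\otimes$ need not be commutative. The canonical order is $a\succeq b\iff a=a\oplus b$, so $a\oplus b$ is the least upper bound. $\mathcal{S}$ is complete if arbitrary (infinite) sums are defined (they are least upper bounds, the empty sum being $\varepsilon$) and $\otimes$ distributes over them on both sides; then $\mathcal{S}$ is a complete lattice, and $a\wedge b$ denotes the greatest lower bound. An order preserving mapping $f:\mathcal{D}\to\mathcal{E}$ between ordered sets is residuated if for every $y\in\mathcal{E}$ the least upper bound of $\{x\in\mathcal{D}\mid f(x)\preceq y\}$ exists and belongs to this set; it is denoted $f^\sharp(y)$, and $f^\sharp$ is the residual of $f$. In a complete semiring $\mathcal{S}$, $a\backslash b$ denotes the greatest solution $x\in\mathcal{S}$ of $a\otimes x\preceq b$ (it exists). A closed interval in $\mathcal{S}$ is a set $\mathbf{x}=[\underline{x},\overline{x}]=\{t\in\mathcal{S}\mid\underline{x}\preceq t\preceq\overline{x}\}$ with $\underline{x}\preceq\overline{x}$. The set $\mathrm{I}(\mathcal{S})$ of closed intervals is a semiring for the operations $\mathbf{x}\mathbin{\overline{\oplus}}\mathbf{y}=[\underline{x}\oplus\underline{y},\overline{x}\oplus\overline{y}]$ and $\mathbf{x}\mathbin{\overline{\otimes}}\mathbf{y}=[\underline{x}\otimes\underline{y},\overline{x}\otimes\overline{y}]$,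 with zero $[\varepsilon,\varepsilon]$ and unit $[e,e]$. Its canonical order is thus $\mathbf{x}\preceq\mathbf{y}\iff\underline{x}\preceq\underline{y}$ and $\overline{x}\preceq\overline{y}$. *)

theory Defs
  imports Main "HOL-Library.Lub_Glb"
begin

text \<open>
  Idempotent semirings, with \<open>\<oplus>, \<otimes>, \<epsilon>, e\<close> written \<open>+, *, 0, 1\<close>.  The library class
  \<open>semiring_1\<close> is avoided because it demands \<open>0 \<noteq> 1\<close>.
\<close>

class idem_semiring = semiring_0 + monoid_mult + ord +
  assumes add_idem: "a + a = a"
    and le_iff_add_eq: "b \<le> a \<longleftrightarrow> a = a + b"
    and less_iff_le_not_le: "a < b \<longleftrightarrow> a \<le> b \<and> \<not> b \<le> a"
begin

subclass order
proof
  fix x y z :: 'a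
  show "x < y \<longleftrightarrow> x \<le> y \<and> \<not> y \<le> x" by (rule less_iff_le_not_le)
  show "x \<le> x" by (simp add: le_iff_add_eq add_idem)
  show "x \<le> z" if "x \<le> y" "y \<le> z"
    using that by (metis le_iff_add_eq add.assoc)
  show "x = y" if "x \<le> y" "y \<le> x"
    using that by (metis le_iff_add_eq add.commute)
qed

lemma add_upper: "a \<le> a + b" "b \<le> a + b"
  by (metis le_iff_add_eq add.assoc add.commute add_idem)+

lemma add_least: "a \<le> c \<Longrightarrow> b \<le> c \<Longrightarrow> a + b \<le> c"
  by (metis le_iff_add_eq add.assoc)

lemma add_mono_idem: "a \<le> b \<Longrightarrow> c \<le> d \<Longrightarrow> a + c \<le> b + d"
  by (meson add_upper add_least order_trans)

lemma mult_mono_idem: "a \<le> b \<Longrightarrow> c \<le> d \<Longrightarrow> a * c \<le> b * d"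
proof -
  assume "a \<le> b" "c \<le> d"
  then have "a * c \<le> b * c" "b * c \<le> b * d"
    by (metis le_iff_add_eq distrib_left distrib_right)+
  then show ?thesis by (rule order_trans)
qed

end

text \<open>
  Infinite sums are the suprema \<open>Sup\<close> of the canonical order; the empty sum
  \<open>Sup {} = bot\<close> is \<open>0\<close>, see \<open>bot_eq_zero\<close> below.
\<close>

class complete_idem_semiring = idem_semiring + complete_lattice +
  assumes mult_Sup_distrib: "a * Sup X = Sup ((\<lambda>x. a * x) ` X)"
    and Sup_mult_distrib: "Sup X * a = Sup ((\<lambda>x. x * a) ` X)"
begin

lemma bot_eq_zero: "bot = 0"
  by (metis le_iff_add_eq add_0_right bot_least order_antisym)

lemma sup_eq_add: "sup a b = a + b"
  by (metis sup.absorb2 sup_least sup_ge1 sup_ge2 add_upper add_least order_antisym)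

end

definition left_quotient :: "'a::complete_idem_semiring \<Rightarrow> 'a \<Rightarrow> 'a" where
  "left_quotient a b = (GREATEST x. a * x \<le> b)"

lemma left_quotient_iff:
  fixes a b x :: "'a::complete_idem_semiring"
  shows "a * x \<le> b \<longleftrightarrow> x \<le> left_quotient a b"
proof -
  let ?s = "Sup {x. a * x \<le> b}"
  have s: "a * ?s \<le> b"
    by (auto simp: mult_Sup_distrib intro: Sup_least)
  have "left_quotient a b = ?s"
    unfolding left_quotient_def using s by (intro Greatest_equality) (auto intro: Sup_upper)
  moreover have "a * x \<le> b" if "x \<le> ?s"
    using mult_mono_idem[OF order_refl that] s by (rule order_trans)
  ultimately show ?thesis by (auto intro: Sup_upper)
qed


definition residuated :: "('d::order \<Rightarrow> 'e::order) \<Rightarrow> bool" where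
  "residuated f \<longleftrightarrow> mono f \<and>
     (\<forall>y. \<exists>z. isLub UNIV {x. f x \<le> y} z \<and> z \<in> {x. f x \<le> y})"

definition residual :: "('d::order \<Rightarrow> 'e::order) \<Rightarrow> 'e \<Rightarrow> 'd" where
  "residual f y = (THE z. isLub UNIV {x. f x \<le> y} z)"


typedef (overloaded) 'a closed_interval =
  "{X :: 'a::order set. \<exists>l u. l \<le> u \<and> X = {l..u}}"
  by auto

text \<open>\<open>ivl l u\<close> is only meaningful for \<open>l \<le> u\<close>.\<close>

definition ivl :: "'a::order \<Rightarrow> 'a \<Rightarrow> 'a closed_interval" where
  "ivl l u = Abs_closed_interval {l..u}"

definition lower :: "'a::order closed_interval \<Rightarrow> 'a" where
  "lower x = (LEAST t. t \<in> Rep_closed_interval x)"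

definition upper :: "'a::order closed_interval \<Rightarrow> 'a" where
  "upper x = (GREATEST t. t \<in> Rep_closed_interval x)"

lemma Rep_ivl: "l \<le> u \<Longrightarrow> Rep_closed_interval (ivl l u) = {l..u}"
  unfolding ivl_def by (rule Abs_closed_interval_inverse) auto

lemma lower_ivl [simp]: "l \<le> u \<Longrightarrow> lower (ivl l u) = l"
  by (auto simp: lower_def Rep_ivl intro: Least_equality)

lemma upper_ivl [simp]: "l \<le> u \<Longrightarrow> upper (ivl l u) = u"
  by (auto simp: upper_def Rep_ivl intro: Greatest_equality)

lemma closed_interval_cases:
  obtains l u where "l \<le> u" "x = ivl l u"
  using Rep_closed_interval[of x] by (auto simp: ivl_def) (metis Rep_closed_interval_inverse)

lemma lower_le_upper [simp]: "lower x \<le> upper x"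
  by (cases x rule: closed_interval_cases) simp

lemma ivl_lower_upper [simp]: "ivl (lower x) (upper x) = x"
  by (cases x rule: closed_interval_cases) simp

lemma closed_interval_eq_iff: "x = y \<longleftrightarrow> lower x = lower y \<and> upper x = upper y"
  by (metis ivl_lower_upper)

instantiation closed_interval :: (idem_semiring) idem_semiring
begin

definition zero_closed_interval :: "'a closed_interval" where
  "0 = ivl 0 0"

definition one_closed_interval :: "'a closed_interval" where
  "1 = ivl 1 1"

definition plus_closed_interval :: "'a closed_interval \<Rightarrow> 'a closed_interval \<Rightarrow> 'a closed_interval" where
  "x + y = ivl (lower x + lower y) (upper x + upper y)"

definition times_closed_interval :: "'a closed_interval \<Rightarrow> 'a closed_interval \<Rightarrow> 'a closed_interval" where
  "x * y = ivl (lower x * lower y) (upper x * upper y)"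

definition less_eq_closed_interval :: "'a closed_interval \<Rightarrow> 'a closed_interval \<Rightarrow> bool" where
  "x \<le> y \<longleftrightarrow> y = y + x" for x y :: "'a closed_interval"

definition less_closed_interval :: "'a closed_interval \<Rightarrow> 'a closed_interval \<Rightarrow> bool" where
  "x < y \<longleftrightarrow> x \<le> y \<and> \<not> y \<le> x" for x y :: "'a closed_interval"

lemma lower_upper_ops:
  fixes x y :: "'a closed_interval"
  shows "lower (0 :: 'a closed_interval) = 0" "upper (0 :: 'a closed_interval) = 0"
    "lower (1 :: 'a closed_interval) = 1" "upper (1 :: 'a closed_interval) = 1"
    "lower (x + y) = lower x + lower y" "upper (x + y) = upper x + upper y"
    "lower (x * y) = lower x * lower y" "upper (x * y) = upper x * upper y"
  by (simp_all add: zero_closed_interval_def one_closed_interval_def plus_closed_interval_def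
      times_closed_interval_def add_mono_idem mult_mono_idem)

instance
  by standard
    (simp_all add: closed_interval_eq_iff lower_upper_ops less_eq_closed_interval_def
      less_closed_interval_def add_idem algebra_simps)

end

lemma closed_interval_le_iff:
  fixes x y :: "'a::idem_semiring closed_interval"
  shows "x \<le> y \<longleftrightarrow> lower x \<le> lower y \<and> upper x \<le> upper y"
  by (simp add: less_eq_closed_interval_def closed_interval_eq_iff lower_upper_ops le_iff_add_eq)

definition interval_left_quotient ::
    "'a::complete_idem_semiring closed_interval \<Rightarrow> 'a closed_interval \<Rightarrow> 'a closed_interval" where
  "interval_left_quotient a x =
     ivl (inf (left_quotient (lower a) (lower x)) (left_quotient (upper a) (upper x)))
         (left_quotient (upper a) (upper x))"

end

theory Submission
  imports Defs
begin

text \<open>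
  The Galois connection \<open>a * x \<le> b \<longleftrightarrow> x \<le> a \ b\<close> holds at both endpoints.  The meet in the lower
  bound of the quotient makes it an interval, and costs nothing: the lower endpoint of any solution
  is below its upper endpoint, hence below the quotient of the upper endpoints.
\<close>

lemma interval_left_quotient_iff:
  fixes a b x :: "'a::complete_idem_semiring closed_interval"
  shows "a * x \<le> b \<longleftrightarrow> x \<le> interval_left_quotient a b"
  using order_trans[OF lower_le_upper[of x]]
  by (auto simp: closed_interval_le_iff lower_upper_ops left_quotient_iff interval_left_quotient_def)

text \<open>The hypothesis makes the set the principal down-set of \<open>g y\<close>, so
  \<open>g y\<close> is even its greatest element.\<close>

lemma galois_isLub:
  fixes f :: "'d::order \<Rightarrow> 'e::order"
  assumes "\<And>x y. f x \<le> y \<longleftrightarrow> x \<le> g y"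
  shows "isLub UNIV {x. f x \<le> y} (g y)"
  using assms by (auto simp: isLub_def leastP_def isUb_def setle_def setge_def)

lemma galois_residuated:
  fixes f :: "'d::order \<Rightarrow> 'e::order"
  assumes "\<And>x y. f x \<le> y \<longleftrightarrow> x \<le> g y"
  shows "residuated f"
proof -
  have "mono f"
  proof
    fix x y :: 'd
    assume "x \<le> y"
    \<comment> \<open>Unit of the adjunction; transposing \<open>x \<le> g (f y)\<close> back then
      gives monotonicity, which is not assumed.\<close>
    also have "y \<le> g (f y)" using assms[of y "f y"] by simp
    finally show "f x \<le> f y" by (simp add: assms)
  qed
  moreover have "isLub UNIV {x. f x \<le> y} (g y) \<and> g y \<in> {x. f x \<le> y}" for y
  proof
    show "isLub UNIV {x. f x \<le> y} (g y)" by (rule galois_isLub) (rule assms)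
    show "g y \<in> {x. f x \<le> y}" by (simp add: assms)
  qed
  ultimately show ?thesis
    unfolding residuated_def by blast
qed

text \<open>Two least upper bounds of one set bound each other, so antisymmetry makes the
  description in \<open>residual\<close> pick out \<open>g y\<close>.\<close>

lemma galois_residual:
  fixes f :: "'d::order \<Rightarrow> 'e::order"
  assumes "\<And>x y. f x \<le> y \<longleftrightarrow> x \<le> g y"
  shows "residual f y = g y"
proof -
  have lub: "isLub UNIV {x. f x \<le> y} (g y)"
    by (rule galois_isLub) (rule assms)
  have "z = g y" if z: "isLub UNIV {x. f x \<le> y} z" for z
  proof (rule order_antisym)
    show "z \<le> g y"
      using z isLub_isUb[OF lub] by (rule isLub_le_isUb)
    show "g y \<le> z"
      using lub isLub_isUb[OF z] by (rule isLub_le_isUb)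
  qed
  with lub show ?thesis
    unfolding residual_def by (rule the_equality)
qed

text \<open>This is the triangle identity \<open>f (g (f x)) = f x\<close>: the counit gives one
  inequality, the unit the other.\<close>

lemma galois_range_eq:
  fixes f :: "'d::order \<Rightarrow> 'e::order"
  assumes "\<And>x y. f x \<le> y \<longleftrightarrow> x \<le> g y" and "y \<in> range f"
  shows "f (g y) = y"
proof -
  have counit: "f (g z) \<le> z" for z by (simp add: assms(1))
  obtain x where y: "y = f x" using assms(2) by (rule rangeE)
  have "x \<le> g y" using y assms(1)[of x y] by simp
  also have "g y \<le> g (f (g y))" using assms(1)[of "g y" "f (g y)"] by simp
  finally have "y \<le> f (g y)" by (simp add: y assms(1))
  with counit show ?thesis by (rule order_antisym)
qed

theorem mainTheorem1:
  fixes a :: "'a::complete_idem_semiring closed_interval"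
  shows "residuated (\<lambda>x. a * x)
    \<and> (\<forall>x. residual (\<lambda>x. a * x) x = interval_left_quotient a x)
    \<and> (\<forall>b. a * interval_left_quotient a b \<le> b
          \<and> (\<forall>x. a * x \<le> b \<longrightarrow> x \<le> interval_left_quotient a b))
    \<and> (\<forall>b. b \<in> range (\<lambda>x. a * x) \<longrightarrow> a * interval_left_quotient a b = b)"
proof (intro conjI allI impI)
  show "residuated (\<lambda>x. a * x)"
    \<comment> \<open>The conclusion of \<open>galois_residuated\<close> does not mention
      \<open>g\<close>; unifying its premise with the interval adjunction sets \<open>g\<close> to
      \<open>interval_left_quotient a\<close>.\<close>
    by (rule galois_residuated, rule interval_left_quotient_iff)
  show "residual (\<lambda>x. a * x) x = interval_left_quotient a x" for x
    by (rule galois_residual, rule interval_left_quotient_iff)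
  show "a * interval_left_quotient a b \<le> b" for b
    by (simp add: interval_left_quotient_iff)
  show "x \<le> interval_left_quotient a b" if "a * x \<le> b" for b x
    using that by (simp add: interval_left_quotient_iff)
  show "a * interval_left_quotient a b = b" if "b \<in> range (\<lambda>x. a * x)" for b
    by (rule galois_range_eq[OF _ that], rule interval_left_quotient_iff)
qed

end
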